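(* Let $\Phi=\{\phi_i\}_{i=1}^n$ be a frame for $\mathbb{R}^m$. If $\Phi$ does weak phaseless reconstruction, then $\Phi$ does phaseless reconstruction.
   Context: A family $\{\phi_i\}_{i=1}^n$ in $\mathbb{R}^m$ is a frame if there are constants $0<A\le B<\infty$ with $A\|x\|^2\le\sum_{i=1}^n|\langle x,\phi_i\rangle|^2\le B\|x\|^2$ for all $x\in\mathbb{R}^m$. $\{\phi_i\}_{i=1}^n$ does weak phaseless reconstruction in $\mathbb{R}^m$ if for all $x=(a_1,\dots,a_m)$ and $y=(b_1,\dots,b_m)$ in $\mathbb{R}^m$ with $|\langle x,\phi_i\rangle|=|\langle y,\phi_i\rangle|$ for all $i=1,\dots,n$, there is $\theta\in\{1,-1\}$ such that $a_i=\theta b_i$ for all $i\in\{1,\dots,m\}$ for which $a_i\neq 0\neq b_i$. $\{\phi_i\}_{i=1}^n$ does phaseless reconstruction in $\mathbb{R}^m$ if for all $x,y\in\mathbb{R}^m$ with $|\langle x,\phi_i\rangle|=|\langle y,\phi_i\rangle|$ for all $i=1,\dots,n$, there is $\theta\in\{1,-1\}$ with $x=\theta y$. *)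

theory Defs
  imports "HOL-Analysis.Analysis"
begin

text \<open>A family of \<open>n\<close> vectors is a function on \<^typ>\<open>nat\<close> of which only the values at
  \<open>1, \<dots>, n\<close> matter; \<open>x $ j\<close> is the \<open>j\<close>-th coordinate in the standard basis of the
  space of real vectors indexed by the finite type \<open>'m\<close>.\<close>

definition is_frame :: "nat \<Rightarrow> (nat \<Rightarrow> real ^ 'm) \<Rightarrow> bool" where
  "is_frame n \<phi> \<longleftrightarrow>
     (\<exists>A B :: real. 0 < A \<and> A \<le> B \<and>
        (\<forall>x. A * (norm x)\<^sup>2 \<le> (\<Sum>i=1..n. \<bar>x \<bullet> \<phi> i\<bar>\<^sup>2) \<and>
             (\<Sum>i=1..n. \<bar>x \<bullet> \<phi> i\<bar>\<^sup>2) \<le> B * (norm x)\<^sup>2))"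

definition weak_phaseless_reconstruction :: "nat \<Rightarrow> (nat \<Rightarrow> real ^ 'm) \<Rightarrow> bool" where
  "weak_phaseless_reconstruction n \<phi> \<longleftrightarrow>
     (\<forall>x y. (\<forall>i\<in>{1..n}. \<bar>x \<bullet> \<phi> i\<bar> = \<bar>y \<bullet> \<phi> i\<bar>) \<longrightarrow>
        (\<exists>\<theta>\<in>{1, -1 :: real}. \<forall>j. x $ j \<noteq> 0 \<and> y $ j \<noteq> 0 \<longrightarrow> x $ j = \<theta> * y $ j))"

definition phaseless_reconstruction :: "nat \<Rightarrow> (nat \<Rightarrow> real ^ 'm) \<Rightarrow> bool" where
  "phaseless_reconstruction n \<phi> \<longleftrightarrow>
     (\<forall>x y. (\<forall>i\<in>{1..n}. \<bar>x \<bullet> \<phi> i\<bar> = \<bar>y \<bullet> \<phi> i\<bar>) \<longrightarrow>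
        (\<exists>\<theta>\<in>{1, -1 :: real}. x = \<theta> *\<^sub>R y))"

end

theory Submission
  imports Defs
begin

text \<open>Put \<open>u = x + y\<close> and \<open>v = x - y\<close>. Since \<open>\<bar>a\<bar> = \<bar>b\<bar>\<close> holds exactly when \<open>a + b = 0\<close> or
  \<open>a - b = 0\<close>, the vectors \<open>x\<close> and \<open>y\<close> have equal measurements iff every \<open>\<phi> i\<close> is orthogonal
  to \<open>u\<close> or to \<open>v\<close>. The condition persists when \<open>u\<close> is replaced by \<open>s u\<close>, so the vectors
  \<open>s u + v\<close> and \<open>s u - v\<close> also have equal measurements, for every \<open>s\<close>. For all but finitely
  many \<open>s\<close> these two vectors have no zero coordinate except at the positions where \<open>u\<close> and
  \<open>v\<close> both vanish (lemma \<open>generic_scaling_no_cancellation\<close>). Weak phaseless reconstruction,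
  which by itself ignores zero coordinates, then forces \<open>s u + v = \<plusminus> (s u - v)\<close> at all
  positions. Hence \<open>v = 0\<close> or \<open>u = 0\<close>, that is, \<open>x = y\<close> or \<open>x = -y\<close>.\<close>

lemma abs_inner_eq_iff_orthogonal_sum_or_diff:
  fixes x y z :: "'a :: real_inner"
  shows "\<bar>x \<bullet> z\<bar> = \<bar>y \<bullet> z\<bar> \<longleftrightarrow> (x + y) \<bullet> z = 0 \<or> (x - y) \<bullet> z = 0"
  unfolding abs_eq_iff inner_add_left inner_diff_left by linarith

text \<open>At a coordinate with \<open>u $ j \<noteq> 0\<close>, the only scalars \<open>s\<close> causing a cancellation are
  \<open>\<plusminus> v $ j / u $ j\<close>; at a coordinate with \<open>u $ j = 0 \<noteq> v $ j\<close> there are none. So there are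
  finitely many scalars to avoid.\<close>

lemma generic_scaling_no_cancellation:
  fixes u v :: "real ^ 'm"
  obtains s where "s \<noteq> 0"
    and "\<And>j. u $ j \<noteq> 0 \<or> v $ j \<noteq> 0 \<Longrightarrow>
           (s *\<^sub>R u + v) $ j \<noteq> 0 \<and> (s *\<^sub>R u - v) $ j \<noteq> 0"
proof -
  let ?bad = "insert 0 (range (\<lambda>j. v $ j / u $ j) \<union> range (\<lambda>j. - (v $ j / u $ j)))"
  have "finite ?bad"
    by simp
  then obtain s :: real where s: "s \<notin> ?bad"
    using ex_new_if_finite[OF infinite_UNIV_char_0] by blast
  have "s * u $ j + v $ j \<noteq> 0 \<and> s * u $ j - v $ j \<noteq> 0"
    if "u $ j \<noteq> 0 \<or> v $ j \<noteq> 0" for j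
  proof (cases "u $ j = 0")
    case True
    with that show ?thesis by simp
  next
    case False
    have "s \<noteq> v $ j / u $ j" "s \<noteq> - (v $ j / u $ j)"
      using s by blast+
    with False show ?thesis
      by (auto simp: field_simps)
  qed
  with s show thesis
    by (intro that[of s]) auto
qed

theorem theorem4p6:
  fixes \<phi> :: "nat \<Rightarrow> real ^ 'm" and n :: nat
  assumes "is_frame n \<phi>"
    and "weak_phaseless_reconstruction n \<phi>"
  shows "phaseless_reconstruction n \<phi>"
  unfolding phaseless_reconstruction_def
proof (intro allI impI)
  fix x y :: "real ^ 'm"
  assume eq: "\<forall>i\<in>{1..n}. \<bar>x \<bullet> \<phi> i\<bar> = \<bar>y \<bullet> \<phi> i\<bar>"
  define u v where "u = x + y" and "v = x - y"
  obtain s where "s \<noteq> 0"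
    and generic: "\<And>j. u $ j \<noteq> 0 \<or> v $ j \<noteq> 0 \<Longrightarrow>
           (s *\<^sub>R u + v) $ j \<noteq> 0 \<and> (s *\<^sub>R u - v) $ j \<noteq> 0"
    by (rule generic_scaling_no_cancellation[of u v]) blast
  have "\<forall>i\<in>{1..n}. \<bar>(s *\<^sub>R u + v) \<bullet> \<phi> i\<bar> = \<bar>(s *\<^sub>R u - v) \<bullet> \<phi> i\<bar>"
  proof
    fix i assume "i \<in> {1..n}"
    with eq have "u \<bullet> \<phi> i = 0 \<or> v \<bullet> \<phi> i = 0"
      unfolding u_def v_def abs_inner_eq_iff_orthogonal_sum_or_diff by blast
    then show "\<bar>(s *\<^sub>R u + v) \<bullet> \<phi> i\<bar> = \<bar>(s *\<^sub>R u - v) \<bullet> \<phi> i\<bar>"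
      by (auto simp: inner_add_left inner_diff_left)
  qed
  then obtain \<theta> :: real where \<theta>: "\<theta> \<in> {1, -1}"
    and weak: "\<forall>j. (s *\<^sub>R u + v) $ j \<noteq> 0 \<and> (s *\<^sub>R u - v) $ j \<noteq> 0 \<longrightarrow>
                 (s *\<^sub>R u + v) $ j = \<theta> * (s *\<^sub>R u - v) $ j"
    using assms(2) unfolding weak_phaseless_reconstruction_def by blast
  \<comment> \<open>Where \<open>u\<close> and \<open>v\<close> both vanish the equation is trivial, so it holds at all coordinates.\<close>
  have all: "s * u $ j + v $ j = \<theta> * (s * u $ j - v $ j)" for j
    using weak generic[of j] by (cases "u $ j = 0 \<and> v $ j = 0") auto
  from \<theta> consider "\<theta> = 1" | "\<theta> = -1" by blast
  then have "x = \<theta> *\<^sub>R y"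
  proof cases
    case 1
    have "v $ j = 0" for j
      using all[of j] 1 by simp
    then have "v = 0" by (simp add: vec_eq_iff)
    with 1 show ?thesis by (simp add: v_def)
  next
    case 2
    have "u $ j = 0" for j
      using all[of j] 2 \<open>s \<noteq> 0\<close> by simp
    then have "u = 0" by (simp add: vec_eq_iff)
    then have "x = - y" by (simp add: u_def eq_neg_iff_add_eq_0)
    with 2 show ?thesis by simp
  qed
  with \<theta> show "\<exists>\<theta>\<in>{1, -1 :: real}. x = \<theta> *\<^sub>R y" by blast
qed

end
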